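(* For every nontrivial regular graph $G$ of degree $\Delta$, $\chi'_{\rm CF}(G)\leq (1+o(1))\log_2\Delta$, where $o(1)$ is a quantity depending only on $\Delta$ and tending to $0$ as $\Delta\to\infty$. That is: for every $\eta>0$ there exists $\Delta_0$ such that for every $\Delta\geq\Delta_0$ and every (finite, simple) $\Delta$-regular graph $G$ (with at least one vertex), $\chi'_{\rm CF}(G)\leq (1+\eta)\log_2\Delta$.
   Context: All graphs are finite and simple. For a graph $G=(V,E)$ without isolated vertices, an edge coloring $c$ of $G$ is any assignment of colors to the edges of $G$ (not necessarily proper). For a vertex $v$, $E_G(v)$ denotes the set of edges of $G$ incident with $v$. For an edge $uv\in E$, its closed neighborhood is $E_G[uv]=E_G(u)\cup E_G(v)$ (so it contains $uv$ itself). An edge $uv$ is satisfied by $c$ if some color appears exactly once on the edges of $E_G[uv]$. The coloring $c$ of $E$ is conflict-free if every edge of $G$ is satisfied. The conflict-free chromatic index $\chi'_{\rm CF}(G)$ is the least number of colors in a conflict-free edge coloring of $G$. Nontrivial regular means regular of degree at least $1$. *)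

theory Defs
  imports Complex_Main
begin

definition simple_graph :: "'a set \<Rightarrow> 'a set set \<Rightarrow> bool" where
  "simple_graph V E \<longleftrightarrow> finite V \<and> (\<forall>e\<in>E. e \<subseteq> V \<and> card e = 2)"

definition incident_edges :: "'a set set \<Rightarrow> 'a \<Rightarrow> 'a set set" where
  "incident_edges E v = {e \<in> E. v \<in> e}"

definition regular_graph :: "nat \<Rightarrow> 'a set \<Rightarrow> 'a set set \<Rightarrow> bool" where
  "regular_graph d V E \<longleftrightarrow>
     simple_graph V E \<and> V \<noteq> {} \<and> (\<forall>v\<in>V. card (incident_edges E v) = d)"

definition closed_edge_nbhd :: "'a set set \<Rightarrow> 'a set \<Rightarrow> 'a set set" where
  "closed_edge_nbhd E e = (\<Union>v\<in>e. incident_edges E v)"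

definition satisfied_edge :: "'a set set \<Rightarrow> ('a set \<Rightarrow> 'c) \<Rightarrow> 'a set \<Rightarrow> bool" where
  "satisfied_edge E c e \<longleftrightarrow> (\<exists>k. \<exists>!f. f \<in> closed_edge_nbhd E e \<and> c f = k)"

definition conflict_free_coloring :: "'a set set \<Rightarrow> ('a set \<Rightarrow> 'c) \<Rightarrow> bool" where
  "conflict_free_coloring E c \<longleftrightarrow> (\<forall>e\<in>E. satisfied_edge E c e)"

(* The edge set is finite, so taking the colors to be natural numbers loses nothing. *)
definition cf_chromatic_index :: "'a set set \<Rightarrow> nat" where
  "cf_chromatic_index E =
     (LEAST k. \<exists>c :: 'a set \<Rightarrow> nat. conflict_free_coloring E c \<and> card (c ` E) = k)"

(* Hence the LEAST above is always attained for a finite simple graph. *)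
lemma conflict_free_coloring_exists:
  assumes "simple_graph V E"
  shows "\<exists>c :: 'a set \<Rightarrow> nat. conflict_free_coloring (E :: 'a set set) c"
proof -
  have "E \<subseteq> Pow V" "finite V"
    using assms by (auto simp: simple_graph_def)
  then have "finite E"
    by (meson finite_Pow_iff finite_subset)
  then obtain c :: "'a set \<Rightarrow> nat" where c: "inj_on c E"
    using finite_imp_inj_to_nat_seg by blast
  have "satisfied_edge E c e" if "e \<in> E" for e
    unfolding satisfied_edge_def
  proof (intro exI[of _ "c e"] ex1I[of _ e])
    have "e \<noteq> {}"
      using assms that by (auto simp: simple_graph_def)
    with that show "e \<in> closed_edge_nbhd E e \<and> c e = c e"
      by (auto simp: closed_edge_nbhd_def incident_edges_def)
  next
    fix f
    assume "f \<in> closed_edge_nbhd E e \<and> c f = c e"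
    with that show "f = e"
      by (auto simp: closed_edge_nbhd_def incident_edges_def dest: inj_onD[OF c])
  qed
  then show ?thesis
    by (auto simp: conflict_free_coloring_def)
qed

end

theory Submission
  imports Defs "HOL-Library.FuncSet" "HOL-Real_Asymp.Real_Asymp"
begin

text \<open>
  A colour \<open>i\<close> satisfies the edge \<open>uv\<close> as soon as one of \<open>u\<close>, \<open>v\<close> is incident with exactly one
  edge of colour \<open>i\<close> and the other with none. So suppose that every vertex \<open>v\<close> has a word
  \<open>X v\<close>, a subset of \<open>{..<k}\<close>, and that the edges of colour \<open>i\<close> are chosen so that \<open>v\<close> lies on
  exactly one of them if \<open>i \<in> X v\<close> and on none otherwise. Then it suffices that adjacent vertices
  have different words, which a greedy choice achieves with \<open>k\<close> about \<open>log 2 D\<close>, where \<open>D\<close> is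
  the degree. All edges left over receive one additional colour.

  Matchings with prescribed sets of covered vertices need not exist, but stars serve as well:
  a vertex that is a leaf in colour \<open>i\<close> has degree one there, whatever happens at the centre of
  its star. The price is that a centre in colour \<open>i\<close> loses the coordinate \<open>i\<close> of its word. Let
  every vertex be a possible centre for a single colour. Then two adjacent words must
  differ outside two coordinates; each neighbour with a word forbids at most four words, and the
  greedy choice succeeds if \<open>2 ^ k > 4 * D\<close>.

  For this, every vertex needs, for every colour \<open>i\<close>, a neighbour that is a centre for \<open>i\<close>, and no
  edge may be claimed in both directions with different colours. The vertices are therefore
  partitioned into \<open>3 * k\<close> parts indexed by a colour and a type modulo 3, and a leaf attaches
  only to centres of the cyclically next type, so that the types orient every edge that is
  used. The partition must let each neighbourhood meet each part. Since \<open>k\<close> is only logarithmic in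
  \<open>D\<close>, such a partition exists by a local argument, and this is where regularity enters:
  \<open>full_coloring_exists\<close> counts the suitable partial partitions and shows that their number grows
  with each vertex added, here by a factor of at least \<open>3 * k - 1/2\<close>.

  With \<open>separating_codewords\<close> for the words and \<open>star_coloring_conflict_free\<close> for the stars, this
  yields at most \<open>log 2 D + 4\<close> colours for all large \<open>D\<close>.
\<close>

section \<open>Colourings of a hypergraph in which every edge sees every colour\<close>

text \<open>
  Colourings of a vertex subset \<open>S\<close> are extensional functions, so that they can be counted. Only
  edges \<open>H i\<close> that lie entirely in \<open>S\<close> are required to see all colours; this makes restrictions
  to smaller sets admissible again.
\<close>
definition full_colorings :: "nat \<Rightarrow> 'i set \<Rightarrow> ('i \<Rightarrow> 'a set) \<Rightarrow> 'a set \<Rightarrow> ('a \<Rightarrow> nat) set" where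
  "full_colorings m I H S =
     {p \<in> S \<rightarrow>\<^sub>E {..<m}. \<forall>i\<in>I. H i \<subseteq> S \<longrightarrow> {..<m} \<subseteq> p ` H i}"

lemma finite_full_colorings: "finite S \<Longrightarrow> finite (full_colorings m I H S)"
  by (rule finite_subset[of _ "S \<rightarrow>\<^sub>E {..<m}"]) (auto simp: full_colorings_def intro: finite_PiE)

lemma restrict_full_colorings:
  assumes "p \<in> full_colorings m I H S" "T \<subseteq> S"
  shows "restrict p T \<in> full_colorings m I H T"
proof -
  have "restrict p T ` H i = p ` H i" if "H i \<subseteq> T" for i
    using that by (intro image_cong) auto
  with assms show ?thesis
    by (auto simp: full_colorings_def PiE_iff)
qed

lemma card_extensions:
  assumes "x \<notin> S" "finite S"
  shows "card {p \<in> insert x S \<rightarrow>\<^sub>E {..<m}. restrict p S \<in> full_colorings m I H S}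
         = m * card (full_colorings m I H S)" (is "card ?Ext = _")
proof -
  have "bij_betw (\<lambda>(a, p). p(x := a)) ({..<m} \<times> full_colorings m I H S) ?Ext"
  proof (rule bij_betw_byWitness[where f' = "\<lambda>p. (p x, restrict p S)"])
    show "\<forall>q\<in>{..<m} \<times> full_colorings m I H S.
        (\<lambda>p. (p x, restrict p S)) ((\<lambda>(a, p). p(x := a)) q) = q"
      using assms by (auto simp: full_colorings_def PiE_iff extensional_def fun_eq_iff)
    show "\<forall>p\<in>?Ext. (\<lambda>(a, p). p(x := a)) ((\<lambda>p. (p x, restrict p S)) p) = p"
      by (auto simp: PiE_iff extensional_def fun_eq_iff)
    have "restrict (p(x := a)) S = p" if "p \<in> full_colorings m I H S" for p a
      using assms that by (auto simp: full_colorings_def PiE_iff extensional_def fun_eq_iff)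
    moreover have "p(x := a) \<in> insert x S \<rightarrow>\<^sub>E {..<m}"
      if "p \<in> full_colorings m I H S" "a < m" for p a
      using that by (auto simp: full_colorings_def PiE_iff extensional_def)
    ultimately show "(\<lambda>(a, p). p(x := a)) ` ({..<m} \<times> full_colorings m I H S) \<subseteq> ?Ext"
      by (intro image_subsetI) (simp add: case_prod_beta mem_Times_iff)
    show "(\<lambda>p. (p x, restrict p S)) ` ?Ext \<subseteq> {..<m} \<times> full_colorings m I H S"
      by (auto simp: PiE_iff)
  qed
  then show ?thesis
    by (simp add: bij_betw_same_card[symmetric] card_cartesian_product)
qed

text \<open>
  An extension that leaves \<open>H i\<close> without the colour \<open>c\<close> is determined by its restriction to the
  vertices outside \<open>H i\<close>, which is again admissible, and by its values on \<open>H i\<close>, for which only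
  \<open>m - 1\<close> colours are available. The hypothesis \<open>x \<in> H i\<close> ensures that these two parts cover
  the new vertex.
\<close>
lemma card_extensions_missing_color:
  assumes "finite S" "H i \<subseteq> insert x S" "x \<in> H i" "card (H i) = d" "c < m"
  shows "card {p \<in> insert x S \<rightarrow>\<^sub>E {..<m}. restrict p S \<in> full_colorings m I H S \<and> c \<notin> p ` H i}
         \<le> card (full_colorings m I H (S - H i)) * (m - 1) ^ d" (is "card ?Bad \<le> _")
proof -
  let ?T = "S - H i"
  let ?split = "\<lambda>p :: 'a \<Rightarrow> nat. (restrict p ?T, restrict p (H i))"
  let ?Target = "full_colorings m I H ?T \<times> (H i \<rightarrow>\<^sub>E ({..<m} - {c}))"
  have fin: "finite (H i)"
    using assms finite_subset by auto
  have "inj_on ?split (insert x S \<rightarrow>\<^sub>E {..<m})"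
  proof (rule inj_onI)
    fix p q assume p: "p \<in> insert x S \<rightarrow>\<^sub>E {..<m}" and q: "q \<in> insert x S \<rightarrow>\<^sub>E {..<m}"
      and eq: "?split p = ?split q"
    have *: "restrict p ?T y = restrict q ?T y" "restrict p (H i) y = restrict q (H i) y" for y
      using eq by auto
    show "p = q"
    proof
      fix y
      show "p y = q y"
      proof (cases "y \<in> S \<union> H i")
        case True
        with *[of y] show ?thesis by (auto split: if_splits)
      next
        case False
        then have "y \<notin> insert x S" using assms(3) by auto
        then show ?thesis using PiE_arb[OF p] PiE_arb[OF q] by simp
      qed
    qed
  qed
  then have "inj_on ?split ?Bad"
    by (rule inj_on_subset) auto
  moreover have "?split ` ?Bad \<subseteq> ?Target"
  proof clarify
    fix p assume p: "p \<in> insert x S \<rightarrow>\<^sub>E {..<m}" "restrict p S \<in> full_colorings m I H S" "c \<notin> p ` H i"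
    have "restrict (restrict p S) ?T \<in> full_colorings m I H ?T"
      using p(2) by (rule restrict_full_colorings) auto
    moreover have "restrict (restrict p S) ?T = restrict p ?T"
      by (auto simp: fun_eq_iff)
    moreover have "restrict p (H i) \<in> H i \<rightarrow>\<^sub>E ({..<m} - {c})"
      using p assms(2) by (auto simp: PiE_iff)
    ultimately show "restrict p ?T \<in> full_colorings m I H ?T \<and>
        restrict p (H i) \<in> H i \<rightarrow>\<^sub>E ({..<m} - {c})"
      by simp
  qed
  moreover have "finite ?Target"
    using assms fin by (auto intro!: finite_PiE finite_full_colorings)
  ultimately have "card ?Bad \<le> card ?Target"
    by (rule card_inj_on_le)
  also have "\<dots> = card (full_colorings m I H ?T) * (m - 1) ^ d"
    using assms fin by (simp add: card_cartesian_product card_PiE)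
  finally show ?thesis .
qed


text \<open>
  Rosenfeld's counting argument, which takes the place of the local lemma. Admissible colourings
  of \<open>S\<close> have \<open>m\<close> times as many extensions to \<open>x\<close>, and those that fail must miss a colour on
  one of the at most \<open>D\<close> edges through \<open>x\<close>. Their number is bounded through the admissible
  colourings of \<open>S - H i\<close>; by induction these are fewer than those of \<open>S\<close> by a factor of at least
  \<open>\<beta> ^ (d - 1)\<close>, because \<open>S\<close> contains the \<open>d - 1\<close> vertices of \<open>H i\<close> other than \<open>x\<close>. The
  hypothesis on \<open>\<beta>\<close> then bounds the failures by \<open>m - \<beta>\<close> for each colouring of \<open>S\<close>.
\<close>
lemma card_full_colorings_growth:
  fixes \<beta> :: real
  assumes fin: "finite V" "finite I" "S \<subseteq> V"
    and edge_size: "\<And>i. i \<in> I \<Longrightarrow> card (H i) = d" and "d > 0"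
    and vertex_degree: "\<And>x. x \<in> V \<Longrightarrow> card {i \<in> I. x \<in> H i} \<le> D"
    and \<beta>: "\<beta> > 0" "real D * m * real (m - 1) ^ d \<le> (m - \<beta>) * \<beta> ^ (d - 1)"
    and x: "x \<in> V" "x \<notin> S"
  shows "\<beta> * card (full_colorings m I H S) \<le> card (full_colorings m I H (insert x S))"
  using fin(3) x
proof (induction "card S" arbitrary: S x rule: less_induct)
  case less
  let ?f = "\<lambda>T. real (card (full_colorings m I H T))"
  have finS: "finite S"
    using less.prems fin finite_subset by blast
  have grow: "\<beta> ^ card U * ?f T \<le> ?f (T \<union> U)"
    if "finite U" "T \<inter> U = {}" "T \<union> U \<subseteq> S" for T U
    using that
  proof (induction U rule: finite_induct)
    case (insert y U)
    have "card (T \<union> U) < card S"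
      using insert finS by (intro psubset_card_mono) auto
    then have "\<beta> * ?f (T \<union> U) \<le> ?f (insert y (T \<union> U))"
      using insert less.prems by (intro less.hyps) auto
    moreover have "\<beta> * (\<beta> ^ card U * ?f T) \<le> \<beta> * ?f (T \<union> U)"
      using insert \<beta> by (intro mult_left_mono) auto
    ultimately show ?case
      using insert by (simp add: mult.assoc)
  qed simp
  let ?J = "{i \<in> I. x \<in> H i \<and> H i \<subseteq> insert x S}"
  let ?Ext = "{p \<in> insert x S \<rightarrow>\<^sub>E {..<m}. restrict p S \<in> full_colorings m I H S}"
  let ?Bad = "\<lambda>(i, c). {p \<in> insert x S \<rightarrow>\<^sub>E {..<m}.
      restrict p S \<in> full_colorings m I H S \<and> c \<notin> p ` H i}"
  have "card ?J \<le> D"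
    using fin less.prems vertex_degree[of x] card_mono[of "{i \<in> I. x \<in> H i}" ?J] by fastforce
  have bad: "real (card (?Bad q)) * \<beta> ^ (d - 1) \<le> real (m - 1) ^ d * ?f S"
    if "q \<in> ?J \<times> {..<m}" for q
  proof -
    obtain i c where "q = (i, c)"
      by (cases q)
    with that have q: "q = (i, c)" "i \<in> I" "x \<in> H i" "H i \<subseteq> insert x S" "c < m"
      by auto
    have "S \<inter> H i = H i - {x}"
      using q less.prems by auto
    then have "card (S \<inter> H i) = d - 1"
      using q edge_size by (simp add: card_Diff_singleton)
    moreover have "(S - H i) \<inter> (S \<inter> H i) = {}" "(S - H i) \<union> (S \<inter> H i) = S"
      by auto
    ultimately have "\<beta> ^ (d - 1) * ?f (S - H i) \<le> ?f S"
      using grow[of "S \<inter> H i" "S - H i"] finS by simp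
    moreover have "real (card (?Bad q)) \<le> ?f (S - H i) * real (m - 1) ^ d"
      using card_extensions_missing_color[where H = H and i = i, OF finS q(4,3) edge_size[OF q(2)] q(5), of I] q(1)
      by (simp flip: of_nat_mult of_nat_power)
    ultimately have "real (card (?Bad q)) * \<beta> ^ (d - 1)
        \<le> ?f (S - H i) * real (m - 1) ^ d * \<beta> ^ (d - 1)"
      "real (m - 1) ^ d * (\<beta> ^ (d - 1) * ?f (S - H i)) \<le> real (m - 1) ^ d * ?f S"
      using \<beta> by (auto intro!: mult_right_mono mult_left_mono)
    then show ?thesis
      by (simp add: mult_ac)
  qed
  have "?Ext \<subseteq> full_colorings m I H (insert x S) \<union> \<Union>(?Bad ` (?J \<times> {..<m}))"
  proof
    fix p assume p: "p \<in> ?Ext"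
    show "p \<in> full_colorings m I H (insert x S) \<union> \<Union>(?Bad ` (?J \<times> {..<m}))"
    proof (cases "\<exists>i\<in>?J. \<exists>c<m. c \<notin> p ` H i")
      case True
      then show ?thesis using p by fastforce
    next
      case False
      have "{..<m} \<subseteq> p ` H i" if "i \<in> I" "H i \<subseteq> insert x S" for i
      proof (cases "x \<in> H i")
        case True
        with False that show ?thesis by auto
      next
        case False
        with that have "H i \<subseteq> S" by auto
        then have "restrict p S ` H i = p ` H i"
          by (intro image_cong) auto
        moreover have "restrict p S \<in> full_colorings m I H S"
          using p by simp
        then have "{..<m} \<subseteq> restrict p S ` H i"
          using that(1) \<open>H i \<subseteq> S\<close> unfolding full_colorings_def mem_Collect_eq by metis
        ultimately show ?thesis
          by (simp only:)
      qed
      then show ?thesis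
        using p by (auto simp: full_colorings_def)
    qed
  qed
  then have "card ?Ext \<le> card (full_colorings m I H (insert x S) \<union> \<Union>(?Bad ` (?J \<times> {..<m})))"
    using finS fin by (intro card_mono)
      (auto intro!: finite_full_colorings intro: finite_subset[OF _ finite_PiE[of "insert x S" "\<lambda>_. {..<m}"]])
  also have "\<dots> \<le> card (full_colorings m I H (insert x S)) + card (\<Union>(?Bad ` (?J \<times> {..<m})))"
    by (rule card_Un_le)
  also have "card (\<Union>(?Bad ` (?J \<times> {..<m}))) \<le> (\<Sum>q\<in>?J \<times> {..<m}. card (?Bad q))"
    using fin by (intro card_UN_le) auto
  finally have "m * ?f S \<le> ?f (insert x S) + (\<Sum>q\<in>?J \<times> {..<m}. real (card (?Bad q)))"
    using card_extensions[OF less.prems(3) finS, of m I H]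
    by (simp flip: of_nat_mult of_nat_sum of_nat_add)
  moreover have "(\<Sum>q\<in>?J \<times> {..<m}. real (card (?Bad q))) \<le> (m - \<beta>) * ?f S"
  proof -
    have "(\<Sum>q\<in>?J \<times> {..<m}. real (card (?Bad q))) * \<beta> ^ (d - 1)
        = (\<Sum>q\<in>?J \<times> {..<m}. real (card (?Bad q)) * \<beta> ^ (d - 1))"
      by (rule sum_distrib_right)
    also have "\<dots> \<le> (\<Sum>q\<in>?J \<times> {..<m}. real (m - 1) ^ d * ?f S)"
      by (rule sum_mono) (rule bad)
    also have "\<dots> = real (card ?J) * (m * (real (m - 1) ^ d * ?f S))"
      by (simp add: card_cartesian_product mult_ac)
    also have "\<dots> \<le> real D * (m * (real (m - 1) ^ d * ?f S))"
      using \<open>card ?J \<le> D\<close> by (intro mult_right_mono) auto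
    also have "\<dots> = (real D * m * real (m - 1) ^ d) * ?f S"
      by (simp add: mult_ac)
    also have "\<dots> \<le> ((m - \<beta>) * \<beta> ^ (d - 1)) * ?f S"
      using \<beta>(2) by (rule mult_right_mono) auto
    finally have "(\<Sum>q\<in>?J \<times> {..<m}. real (card (?Bad q))) * \<beta> ^ (d - 1)
        \<le> ((m - \<beta>) * ?f S) * \<beta> ^ (d - 1)"
      by (simp add: mult_ac)
    then show ?thesis
      using \<beta>(1) by (simp add: mult_le_cancel_right)
  qed
  ultimately show ?case
    by (simp add: algebra_simps)
qed

lemma full_coloring_exists:
  fixes \<beta> :: real
  assumes fin: "finite V" "finite I"
    and edges: "\<And>i. i \<in> I \<Longrightarrow> H i \<subseteq> V" "\<And>i. i \<in> I \<Longrightarrow> card (H i) = d" "d > 0"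
    and vertex_degree: "\<And>x. x \<in> V \<Longrightarrow> card {i \<in> I. x \<in> H i} \<le> D"
    and \<beta>: "\<beta> > 0" "real D * m * real (m - 1) ^ d \<le> (m - \<beta>) * \<beta> ^ (d - 1)"
  obtains p where "p ` V \<subseteq> {..<m}" "\<And>i. i \<in> I \<Longrightarrow> {..<m} \<subseteq> p ` H i"
proof -
  have "full_colorings m I H S \<noteq> {}" if "S \<subseteq> V" "finite S" for S
    using that(2,1)
  proof (induction S rule: finite_induct)
    case empty
    have "H i \<noteq> {}" if "i \<in> I" for i
      using edges(2,3) that by fastforce
    then have "(\<lambda>_. undefined) \<in> full_colorings m I H {}"
      by (auto simp: full_colorings_def)
    then show ?case by blast
  next
    case (insert x S)
    then have "0 < \<beta> * card (full_colorings m I H S)"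
      using \<beta>(1) by (simp add: card_gt_0_iff finite_full_colorings)
    also have "\<dots> \<le> card (full_colorings m I H (insert x S))"
      using insert by (intro card_full_colorings_growth[OF fin _ edges(2,3) vertex_degree \<beta>]) auto
    finally show ?case
      by auto
  qed
  then obtain p where "p \<in> full_colorings m I H V"
    using fin by blast
  then show ?thesis
    using edges(1) by (intro that[of p]) (auto simp: full_colorings_def)
qed

section \<open>Greedy codewords\<close>

text \<open>Once its part outside the pair is fixed, at most four choices remain inside the pair.\<close>
lemma card_words_agreeing_off_pair:
  "card {A \<in> Pow {..<k}. A - {a, b :: nat} = W} \<le> 4"
proof -
  have "A \<in> (\<lambda>B. W \<union> B) ` Pow {a, b}" if "A - {a, b} = W" for A
    using that by (intro image_eqI[of _ _ "A \<inter> {a, b}"]) auto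
  then have "card {A \<in> Pow {..<k}. A - {a, b} = W} \<le> card ((\<lambda>B. W \<union> B) ` Pow {a, b})"
    by (intro card_mono) auto
  also have "\<dots> \<le> card (Pow {a, b})"
    by (rule card_image_le) auto
  also have "\<dots> \<le> 4"
    by (simp add: card_Pow card_insert_if)
  finally show ?thesis .
qed

text \<open>
  The two coordinates \<open>j u\<close> and \<open>j v\<close> cannot be used to distinguish \<open>u\<close> from \<open>v\<close>. As this
  makes every neighbour forbid up to four words, the greedy choice costs two coordinates more than
  an ordinary greedy vertex colouring.
\<close>
lemma separating_codewords:
  fixes j :: "'a \<Rightarrow> nat"
  assumes "finite V"
    and "\<And>v. v \<in> V \<Longrightarrow> finite (N v) \<and> card (N v) \<le> D"
    and sym: "\<And>u v. u \<in> N v \<Longrightarrow> v \<in> N u" and irrefl: "\<And>v. v \<notin> N v"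
    and "4 * D < 2 ^ k"
  obtains X where "\<And>v. v \<in> V \<Longrightarrow> X v \<subseteq> {..<k}"
    and "\<And>u v. u \<in> V \<Longrightarrow> v \<in> V \<Longrightarrow> u \<in> N v \<Longrightarrow> X u - {j u, j v} \<noteq> X v - {j u, j v}"
proof -
  have "\<exists>X. (\<forall>v\<in>V. X v \<subseteq> {..<k}) \<and>
      (\<forall>u\<in>V. \<forall>v\<in>V. u \<in> N v \<longrightarrow> X u - {j u, j v} \<noteq> X v - {j u, j v})"
    using assms(1,2)
  proof (induction V rule: finite_induct)
    case (insert v V)
    then obtain X where X: "\<forall>v\<in>V. X v \<subseteq> {..<k}"
        "\<forall>u\<in>V. \<forall>v\<in>V. u \<in> N v \<longrightarrow> X u - {j u, j v} \<noteq> X v - {j u, j v}"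
      by auto
    let ?Forbidden = "\<Union>u\<in>N v. {A \<in> Pow {..<k}. A - {j u, j v} = X u - {j u, j v}}"
    have N: "finite (N v)" "card (N v) \<le> D"
      using insert.prems by auto
    have "card ?Forbidden \<le> (\<Sum>u\<in>N v. card {A \<in> Pow {..<k}. A - {j u, j v} = X u - {j u, j v}})"
      using N by (intro card_UN_le)
    also have "\<dots> \<le> (\<Sum>u\<in>N v. 4)"
      by (intro sum_mono card_words_agreeing_off_pair)
    also have "\<dots> < card (Pow {..<k})"
      using N assms(5) by (simp add: card_Pow)
    finally have "\<not> Pow {..<k} \<subseteq> ?Forbidden"
      using card_mono[of ?Forbidden "Pow {..<k}"] N by fastforce
    then obtain A where "A \<in> Pow {..<k}" "A \<notin> ?Forbidden"
      by blast
    then have A: "A \<subseteq> {..<k}" "\<forall>u\<in>N v. A - {j u, j v} \<noteq> X u - {j u, j v}"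
      by auto
    have "\<forall>u\<in>insert v V. \<forall>w\<in>insert v V. u \<in> N w \<longrightarrow>
        (X(v := A)) u - {j u, j w} \<noteq> (X(v := A)) w - {j u, j w}"
    proof (intro ballI impI)
      fix u w assume "u \<in> insert v V" "w \<in> insert v V" "u \<in> N w"
      then consider "u = v" "w \<in> V" "w \<noteq> v" "w \<in> N v" | "w = v" "u \<in> V" "u \<noteq> v" "u \<in> N v"
        | "u \<noteq> v" "w \<noteq> v" "u \<in> V" "w \<in> V"
        using irrefl sym by auto
      then show "(X(v := A)) u - {j u, j w} \<noteq> (X(v := A)) w - {j u, j w}"
        using X A \<open>u \<in> N w\<close> by cases (auto simp: insert_commute)
    qed
    with X A show ?case
      by (intro exI[of _ "X(v := A)"]) auto
  qed auto
  then obtain X where "\<forall>v\<in>V. X v \<subseteq> {..<k}"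
      "\<forall>u\<in>V. \<forall>v\<in>V. u \<in> N v \<longrightarrow> X u - {j u, j v} \<noteq> X v - {j u, j v}"
    by (elim exE conjE)
  then show ?thesis
    by (intro that[of X]) simp_all
qed

section \<open>Colour classes that are forests of stars\<close>

lemma no_mutual_successors_mod_3:
  fixes a b :: nat
  assumes "a mod 3 = Suc b mod 3" "b mod 3 = Suc a mod 3"
  shows False
proof -
  have "a mod 3 = 0 \<and> Suc (b mod 3) = 3 \<or> a mod 3 = Suc (b mod 3)"
    using assms(1) by (simp add: mod_Suc split: if_splits)
  moreover have "b mod 3 = 0 \<and> Suc (a mod 3) = 3 \<or> b mod 3 = Suc (a mod 3)"
    using assms(2) by (simp add: mod_Suc split: if_splits)
  ultimately show False
    by (elim disjE conjE) linarith+
qed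

text \<open>
  The part \<open>p v\<close> encodes the pair of a colour \<open>p v div 3\<close> and a type \<open>p v mod 3\<close>. For
  \<open>i \<in> X v\<close> other than its own colour, \<open>v\<close> chooses an edge of colour \<open>i\<close> to a neighbour whose
  colour is \<open>i\<close> and whose type follows that of \<open>v\<close>. As all centres in colour \<open>i\<close> have
  \<open>p u div 3 = i\<close>, any other vertex meets colour \<open>i\<close> only in the edge it has chosen.
\<close>
lemma star_coloring_conflict_free:
  fixes p :: "'a \<Rightarrow> nat"
  assumes E: "\<And>e. e \<in> E \<Longrightarrow> e \<subseteq> V \<and> card e = 2"
    and dom: "\<And>v q. v \<in> V \<Longrightarrow> q < 3 * k \<Longrightarrow> \<exists>u. {v, u} \<in> E \<and> p u = q"
    and X: "\<And>v. v \<in> V \<Longrightarrow> X v \<subseteq> {..<k}"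
    and sep: "\<And>u v. {u, v} \<in> E \<Longrightarrow> X u - {p u div 3, p v div 3} \<noteq> X v - {p u div 3, p v div 3}"
  shows "\<exists>col :: 'a set \<Rightarrow> nat. conflict_free_coloring E col \<and> col ` E \<subseteq> {..k}"
proof -
  define j where "j v = p v div 3" for v
  define centre where "centre v i = (SOME u. {v, u} \<in> E \<and> p u = 3 * i + Suc (p v) mod 3)" for v i
  have centre: "{v, centre v i} \<in> E" "p (centre v i) = 3 * i + Suc (p v) mod 3"
    if "v \<in> V" "i < k" for v i
  proof -
    have "\<exists>u. {v, u} \<in> E \<and> p u = 3 * i + Suc (p v) mod 3"
      using that by (intro dom) linarith+
    from someI_ex[OF this] show "{v, centre v i} \<in> E" "p (centre v i) = 3 * i + Suc (p v) mod 3"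
      unfolding centre_def by auto
  qed
  have j_centre: "j (centre v i) = i" if "v \<in> V" "i < k" for v i
    using centre(2)[OF that] by (simp add: j_def)
  define F where "F i = {{v, centre v i} |v. v \<in> V \<and> i \<in> X v \<and> j v \<noteq> i}" for i
  \<comment> \<open>An edge chosen from both ends would make each type the successor of the other modulo 3.\<close>
  have disjoint: "i = i'" if e: "e \<in> F i" "e \<in> F i'" "i < k" "i' < k" for e i i'
  proof -
    obtain v where v: "e = {v, centre v i}" "v \<in> V"
      using e(1) unfolding F_def by blast
    obtain v' where v': "e = {v', centre v' i'}" "v' \<in> V"
      using e(2) unfolding F_def by blast
    from v v' consider "v = v'" "centre v i = centre v' i'" | "v = centre v' i'" "v' = centre v i"
      by (auto simp: doubleton_eq_iff)
    then show ?thesis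
    proof cases
      case 1
      have "i = j (centre v i)"
        by (rule j_centre[OF v(2) e(3), symmetric])
      also have "\<dots> = j (centre v' i')"
        by (simp only: 1(2))
      also have "\<dots> = i'"
        by (rule j_centre[OF v'(2) e(4)])
      finally show ?thesis .
    next
      case 2
      have "p v = 3 * i' + Suc (p v') mod 3"
        by (subst 2(1)) (rule centre(2)[OF v'(2) e(4)])
      from arg_cong[OF this, of "\<lambda>n. n mod 3"] have "p v mod 3 = Suc (p v') mod 3"
        by simp
      moreover have "p v' = 3 * i + Suc (p v) mod 3"
        by (subst 2(2)) (rule centre(2)[OF v(2) e(3)])
      from arg_cong[OF this, of "\<lambda>n. n mod 3"] have "p v' mod 3 = Suc (p v) mod 3"
        by simp
      ultimately have False
        by (rule no_mutual_successors_mod_3)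
      then show ?thesis ..
    qed
  qed
  define col where "col e = (if \<exists>i<k. e \<in> F i then (SOME i. i < k \<and> e \<in> F i) else k)" for e
  have col: "col e = i \<longleftrightarrow> e \<in> F i" if "i < k" for e i
  proof (cases "\<exists>i<k. e \<in> F i")
    case True
    then have "col e < k \<and> e \<in> F (col e)"
      unfolding col_def using someI_ex[OF True] by auto
    then show ?thesis
      using disjoint that by auto
  next
    case False
    then show ?thesis
      using that by (auto simp: col_def)
  qed
  have "col e \<le> k" for e
  proof (cases "\<exists>i<k. e \<in> F i")
    case True
    then show ?thesis
      unfolding col_def using someI_ex[OF True] by auto
  qed (auto simp: col_def)
  have star_leaf: "e = {v, centre v i} \<and> i \<in> X v"
    if "e \<in> F i" "i < k" "v \<in> e" "j v \<noteq> i" for e v i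
    using that j_centre by (auto simp: F_def)
  have separated: "satisfied_edge E col {u, v}"
    if uv: "{u, v} \<in> E" and i: "i \<in> X u" "i \<notin> X v" "i \<noteq> j u" "i \<noteq> j v" for u v i
    unfolding satisfied_edge_def
  proof (intro exI[of _ i] ex1I[of _ "{u, centre u i}"])
    have "u \<in> V" using E[OF uv] by auto
    with X i have "i < k" by auto
    have "{u, centre u i} \<in> F i"
      using \<open>u \<in> V\<close> i by (auto simp: F_def)
    with \<open>i < k\<close> show "{u, centre u i} \<in> closed_edge_nbhd E {u, v} \<and> col {u, centre u i} = i"
      using centre(1)[OF \<open>u \<in> V\<close>] by (auto simp: closed_edge_nbhd_def incident_edges_def col)
    fix f assume "f \<in> closed_edge_nbhd E {u, v} \<and> col f = i"
    then have "f \<in> F i" "u \<in> f \<or> v \<in> f"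
      using \<open>i < k\<close> by (auto simp: closed_edge_nbhd_def incident_edges_def col)
    then show "f = {u, centre u i}"
      using star_leaf[OF _ \<open>i < k\<close>] i by blast
  qed
  have "satisfied_edge E col e" if e_in: "e \<in> E" for e
  proof -
    obtain u v where e: "e = {u, v}"
      using E[OF e_in] by (auto simp: card_2_iff)
    then obtain i where i: "i \<noteq> j u" "i \<noteq> j v" "i \<in> X u \<and> i \<notin> X v \<or> i \<in> X v \<and> i \<notin> X u"
      using sep[of u v] e_in unfolding j_def by blast
    then show ?thesis
      using separated[of u v i] separated[of v u i] e_in e by (auto simp: insert_commute)
  qed
  with \<open>\<And>e. col e \<le> k\<close> show ?thesis
    by (intro exI[of _ col]) (auto simp: conflict_free_coloring_def)
qed

lemma card_neighbours:
  assumes "\<And>e. e \<in> E \<Longrightarrow> card e = 2"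
  shows "card {u. {v, u} \<in> E} = card (incident_edges E v)"
proof -
  have "bij_betw (\<lambda>u. {v, u}) {u. {v, u} \<in> E} (incident_edges E v)"
    unfolding bij_betw_def
  proof
    show "inj_on (\<lambda>u. {v, u}) {u. {v, u} \<in> E}"
      by (auto simp: inj_on_def doubleton_eq_iff)
    have "e \<in> (\<lambda>u. {v, u}) ` {u. {v, u} \<in> E}" if e: "e \<in> E" "v \<in> e" for e
    proof -
      obtain a b where "e = {a, b}"
        using assms[OF e(1)] by (auto simp: card_2_iff)
      with e(2) have "e = {v, b} \<or> e = {v, a}"
        by auto
      with e(1) show ?thesis by auto
    qed
    then show "(\<lambda>u. {v, u}) ` {u. {v, u} \<in> E} = incident_edges E v"
      by (auto simp: incident_edges_def)
  qed
  then show ?thesis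
    by (rule bij_betw_same_card)
qed

lemma cf_chromatic_index_le:
  fixes \<beta> :: real
  assumes G: "regular_graph D V E" and "D > 0" and k: "4 * D < 2 ^ k"
    and \<beta>: "\<beta> > 0" "real D * (3 * k) * real (3 * k - 1) ^ D \<le> (3 * k - \<beta>) * \<beta> ^ (D - 1)"
  shows "cf_chromatic_index E \<le> k + 1"
proof -
  have V: "finite V" and E: "\<And>e. e \<in> E \<Longrightarrow> e \<subseteq> V \<and> card e = 2"
    and deg: "\<And>v. v \<in> V \<Longrightarrow> card (incident_edges E v) = D"
    using G by (auto simp: regular_graph_def simple_graph_def)
  define N where "N v = {u. {v, u} \<in> E}" for v
  have N: "N v \<subseteq> V" for v
    using E by (auto simp: N_def)
  have cardN: "card (N v) = D" if "v \<in> V" for v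
    using card_neighbours[of E v] E deg[OF that] by (auto simp: N_def)
  have symN: "v \<in> N u" if "u \<in> N v" for u v
    using that by (auto simp: N_def insert_commute)
  have irreflN: "v \<notin> N v" for v
    using E by (fastforce simp: N_def)
  have "{v \<in> V. x \<in> N v} = N x" for x
    using symN N by auto
  then have "card {v \<in> V. x \<in> N v} \<le> D" if "x \<in> V" for x
    using cardN that by simp
  with V N cardN \<open>D > 0\<close> \<beta> obtain p
    where "p ` V \<subseteq> {..<3 * k}" and p: "\<And>v. v \<in> V \<Longrightarrow> {..<3 * k} \<subseteq> p ` N v"
    by (elim full_coloring_exists[where V = V and I = V and H = N and d = D and D = D
          and \<beta> = \<beta> and m = "3 * k", rotated -1]) simp_all
  have finN: "finite (N v) \<and> card (N v) \<le> D" if "v \<in> V" for v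
    using finite_subset[OF N V] cardN[OF that] by simp
  obtain X where X: "\<And>v. v \<in> V \<Longrightarrow> X v \<subseteq> {..<k}"
    and sep: "\<And>u v. u \<in> V \<Longrightarrow> v \<in> V \<Longrightarrow> u \<in> N v \<Longrightarrow>
        X u - {p u div 3, p v div 3} \<noteq> X v - {p u div 3, p v div 3}"
    by (rule separating_codewords[of V N D k "\<lambda>v. p v div 3", OF V finN symN irreflN k],
        assumption+) (rule that)
  have "\<exists>u. {v, u} \<in> E \<and> p u = q" if "v \<in> V" "q < 3 * k" for v q
    using p[OF that(1)] that(2) by (auto simp: N_def)
  moreover have "X u - {p u div 3, p v div 3} \<noteq> X v - {p u div 3, p v div 3}" if "{u, v} \<in> E" for u v
    using E[OF that] that by (intro sep) (auto simp: N_def insert_commute)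
  ultimately obtain col :: "'a set \<Rightarrow> nat" where col: "conflict_free_coloring E col" "col ` E \<subseteq> {..k}"
    using star_coloring_conflict_free[of E V k p X] E X by blast
  have "cf_chromatic_index E \<le> card (col ` E)"
    unfolding cf_chromatic_index_def using col by (intro Least_le) auto
  also have "\<dots> \<le> card {..k}"
    using col by (intro card_mono) auto
  finally show ?thesis by simp
qed

section \<open>The logarithmic bound\<close>

text \<open>
  The growth factor \<open>m - 1/2\<close> leaves half a colour per vertex to be spent on failures, while
  the ratio of \<open>m - 1\<close> to \<open>m - 1/2\<close> is at most \<open>exp (- 1 / (2 * m))\<close>. Its power with exponent
  \<open>D - 1\<close> beats any polynomial in \<open>D\<close> when \<open>m\<close> is logarithmic in \<open>D\<close>.
\<close>
lemma growth_condition: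
  assumes "m \<ge> 1" "D \<ge> 1" "2 * real D * m ^ 2 * exp (- (real D - 1) / (2 * m)) \<le> 1"
  shows "real D * m * real (m - 1) ^ D \<le> (m - (m - 1/2)) * (m - 1/2) ^ (D - 1)"
proof -
  let ?b = "real m - 1/2"
  have "real (m - 1) \<le> ?b * (1 - 1 / (2 * m))"
    using assms by (simp add: field_simps of_nat_diff)
  also have "\<dots> \<le> ?b * exp (- 1 / (2 * m))"
    using assms exp_ge_add_one_self[of "- 1 / (2 * real m)"] by (intro mult_left_mono) auto
  finally have "real (m - 1) ^ (D - 1) \<le> (?b * exp (- 1 / (2 * m))) ^ (D - 1)"
    by (intro power_mono) auto
  also have "\<dots> = ?b ^ (D - 1) * exp (- (real D - 1) / (2 * m))"
  proof -
    have "real (D - 1) * (- 1 / (2 * m)) = - (real D - 1) / (2 * m)"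
      using assms by (simp add: of_nat_diff field_simps)
    then show ?thesis
      by (simp only: power_mult_distrib exp_of_nat_mult[symmetric])
  qed
  finally have *: "real (m - 1) ^ (D - 1) \<le> ?b ^ (D - 1) * exp (- (real D - 1) / (2 * m))" .
  have "real (m - 1) ^ D = real (m - 1) * real (m - 1) ^ (D - 1)"
    using assms by (simp flip: power_Suc)
  also have "\<dots> \<le> m * (?b ^ (D - 1) * exp (- (real D - 1) / (2 * m)))"
    using * by (intro mult_mono) auto
  finally have "real D * m * real (m - 1) ^ D
      \<le> real D * m * (m * (?b ^ (D - 1) * exp (- (real D - 1) / (2 * m))))"
    by (intro mult_left_mono) auto
  also have "\<dots> = (2 * real D * m ^ 2 * exp (- (real D - 1) / (2 * m))) * (?b ^ (D - 1) / 2)"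
    by (simp add: power2_eq_square)
  also have "\<dots> \<le> 1 * (?b ^ (D - 1) / 2)"
    using assms by (intro mult_right_mono) auto
  finally show ?thesis by simp
qed

theorem theorem2:
  shows "\<forall>\<eta>::real. \<eta> > 0 \<longrightarrow>
    (\<exists>\<Delta>\<^sub>0\<ge>1. \<forall>\<Delta>\<ge>\<Delta>\<^sub>0. \<forall>(V :: 'a set) (E :: 'a set set).
      regular_graph \<Delta> V E \<longrightarrow>
      real (cf_chromatic_index E) \<le> (1 + \<eta>) * log 2 (real \<Delta>))"
proof (intro allI impI)
  fix \<eta> :: real assume "\<eta> > 0"
  \<comment> \<open>An upper bound for the number \<open>3 * k\<close> of parts, where \<open>k\<close> is at most \<open>log 2 D + 3\<close>.\<close>
  let ?L = "\<lambda>D. 3 * log 2 (real D) + 9"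
  have "\<forall>\<^sub>F D in sequentially. 2 * real D * ?L D ^ 2 * exp (- (real D - 1) / (2 * ?L D)) \<le> 1"
    by real_asymp
  moreover have "\<forall>\<^sub>F D in sequentially. log 2 (real D) + 4 \<le> (1 + \<eta>) * log 2 (real D)"
    using \<open>\<eta> > 0\<close> by real_asymp
  ultimately have "\<forall>\<^sub>F D in sequentially.
      2 * real D * ?L D ^ 2 * exp (- (real D - 1) / (2 * ?L D)) \<le> 1 \<and>
      log 2 (real D) + 4 \<le> (1 + \<eta>) * log 2 (real D)"
    by (rule eventually_conj)
  then obtain D0 where D0: "\<And>D. D \<ge> D0 \<Longrightarrow>
      2 * real D * ?L D ^ 2 * exp (- (real D - 1) / (2 * ?L D)) \<le> 1 \<and>
      log 2 (real D) + 4 \<le> (1 + \<eta>) * log 2 (real D)"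
    by (auto simp: eventually_sequentially)
  have "real (cf_chromatic_index E) \<le> (1 + \<eta>) * log 2 (real D)"
    if "D \<ge> max 1 D0" and G: "regular_graph D V E" for D and V :: "'a set" and E
  proof -
    have "D \<ge> 1" using that by simp
    then have "log 2 (real D) \<ge> 0" by simp
    define k where "k = nat \<lfloor>log 2 (real D)\<rfloor> + 3"
    have k: "real k \<le> log 2 (real D) + 3" "log 2 (real D) + 2 < real k"
      using \<open>log 2 (real D) \<ge> 0\<close> by (simp_all add: k_def) linarith+
    have "real (4 * D) = 2 powr (log 2 (real D) + 2)"
      using \<open>D \<ge> 1\<close> by (simp add: powr_add)
    also have "\<dots> < 2 powr real k"
      using k by (intro powr_less_mono) auto
    also have "\<dots> = real (2 ^ k)"
      by (simp add: powr_realpow)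
    finally have "4 * D < 2 ^ k"
      by (simp only: of_nat_less_iff)
    define m where "m = 3 * k"
    have m: "m \<ge> 1" "real m \<le> ?L D"
      using k by (simp_all add: m_def k_def)
    have "2 * real D * real m ^ 2 * exp (- (real D - 1) / (2 * real m))
        \<le> 2 * real D * ?L D ^ 2 * exp (- (real D - 1) / (2 * ?L D))"
    proof (intro mult_mono power_mono)
      show "exp (- (real D - 1) / (2 * real m)) \<le> exp (- (real D - 1) / (2 * ?L D))"
      proof -
        have "(real D - 1) / (2 * ?L D) \<le> (real D - 1) / (2 * real m)"
          using m \<open>D \<ge> 1\<close> by (intro divide_left_mono) auto
        then show ?thesis
          by (simp only: minus_divide_left[symmetric] exp_le_cancel_iff neg_le_iff_le)
      qed
    qed (use m in auto)
    also have "\<dots> \<le> 1"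
      using D0[of D] that by auto
    finally have "real D * m * real (m - 1) ^ D \<le> (m - (m - 1/2)) * (m - 1/2) ^ (D - 1)"
      using m \<open>D \<ge> 1\<close> by (intro growth_condition) auto
    then have "cf_chromatic_index E \<le> k + 1"
      using m \<open>D \<ge> 1\<close> \<open>4 * D < 2 ^ k\<close>
      by (intro cf_chromatic_index_le[OF G, where \<beta> = "real m - 1/2"]) (auto simp: m_def)
    then have "real (cf_chromatic_index E) \<le> log 2 (real D) + 4"
      using k by linarith
    then show ?thesis
      using D0[of D] that by auto
  qed
  then show "\<exists>\<Delta>\<^sub>0\<ge>1. \<forall>\<Delta>\<ge>\<Delta>\<^sub>0. \<forall>(V :: 'a set) (E :: 'a set set).
      regular_graph \<Delta> V E \<longrightarrow>
      real (cf_chromatic_index E) \<le> (1 + \<eta>) * log 2 (real \<Delta>)"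
    by (intro exI[of _ "max 1 D0"]) auto
qed

end
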